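(* If $\mathcal A$ is a $1$-edge differentially private mechanism that answers connected-component-count queries on graphs with $n$ vertices in the continual release model for fully dynamic streams of length $T$, such that with probability at least $0.99$ every output is within additive error $\zeta$ of the true number of connected components, then $\zeta=\Omega(\min(\sqrt n,\,T^{1/4}))$. Moreover, this holds even if accuracy is only required on streams in which every intermediate graph is bipartite, has maximum degree $2$, and has arboricity $2$.
   Context: A fully dynamic stream of length $T$ on a fixed vertex set of size $n$ is a sequence of updates, each an edge insertion, an edge deletion, or the empty update $\bot$. Two streams are edge-neighboring if they differ in exactly one timestep $t^*$, where one has $\bot$ and the other an edge insertion or deletion. A mechanism is $\varepsilon$-edge DP if for all edge-neighboring streams $S,S'$ and all output sets $Y$, $\Pr[\mathcal A(S)\in Y]\le e^\varepsilon\Pr[\mathcal A(S')\in Y]$. Arboricity is the minimum number of forests partitioning the edge set. The $\Omega$ hides an absolute constant and holds for $n$ sufficiently large. *)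

theory Defs
  imports "HOL-Probability.Probability"
begin

section \<open>Simple graphs on the vertex set \<open>{..<n}\<close>\<close>

type_synonym edge = "nat set"

definition edges_on :: "nat \<Rightarrow> edge set" where
  "edges_on n = {e. e \<subseteq> {..<n} \<and> card e = 2}"

definition connectivity :: "nat \<Rightarrow> edge set \<Rightarrow> (nat \<times> nat) set" where
  "connectivity n E = {(u, v). {u, v} \<in> E}\<^sup>* \<inter> {..<n} \<times> {..<n}"

definition num_components :: "nat \<Rightarrow> edge set \<Rightarrow> nat" where
  "num_components n E = card ({..<n} // connectivity n E)"

definition bipartite :: "nat \<Rightarrow> edge set \<Rightarrow> bool" where
  "bipartite n E \<longleftrightarrow>
     (\<exists>A B. A \<union> B = {..<n} \<and> A \<inter> B = {} \<and> (\<forall>e\<in>E. \<exists>a\<in>A. \<exists>b\<in>B. e = {a, b}))"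

definition vertex_degree :: "edge set \<Rightarrow> nat \<Rightarrow> nat" where
  "vertex_degree E v = card {e \<in> E. v \<in> e}"

text \<open>Meaningful for \<open>n > 0\<close> only.\<close>

definition max_degree :: "nat \<Rightarrow> edge set \<Rightarrow> nat" where
  "max_degree n E = Max (vertex_degree E ` {..<n})"

definition is_cycle :: "edge set \<Rightarrow> nat list \<Rightarrow> bool" where
  "is_cycle E vs \<longleftrightarrow> 3 \<le> length vs \<and> distinct vs \<and>
     (\<forall>i<length vs. {vs ! i, vs ! (Suc i mod length vs)} \<in> E)"

definition forest :: "edge set \<Rightarrow> bool" where
  "forest E \<longleftrightarrow> \<not> (\<exists>vs. is_cycle E vs)"

text \<open>Classes of the partition may be empty, which does not affect the minimum.\<close>

definition arboricity :: "edge set \<Rightarrow> nat" where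
  "arboricity E = (LEAST k. \<exists>F :: nat \<Rightarrow> edge set.
     E = (\<Union>i<k. F i) \<and> disjoint_family_on F {..<k} \<and> (\<forall>i<k. forest (F i)))"

section \<open>Fully dynamic streams\<close>

datatype update = Insertion edge | Deletion edge | Bot

definition updates :: "nat \<Rightarrow> update set" where
  "updates n = Insertion ` edges_on n \<union> Deletion ` edges_on n \<union> {Bot}"

definition dynamic_streams :: "nat \<Rightarrow> nat \<Rightarrow> update list set" where
  "dynamic_streams n T = {S. length S = T \<and> set S \<subseteq> updates n}"

text \<open>Inserting a present edge and deleting an absent one leave the graph unchanged.\<close>

fun apply_update :: "update \<Rightarrow> edge set \<Rightarrow> edge set" where
  "apply_update (Insertion e) E = insert e E"
| "apply_update (Deletion e) E = E - {e}"
| "apply_update Bot E = E"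

definition graph_at :: "update list \<Rightarrow> nat \<Rightarrow> edge set" where
  "graph_at S t = fold apply_update (take t S) {}"

definition restricted_streams :: "nat \<Rightarrow> nat \<Rightarrow> update list set" where
  "restricted_streams n T = {S \<in> dynamic_streams n T. \<forall>t\<in>{1..T}.
     bipartite n (graph_at S t) \<and> max_degree n (graph_at S t) \<le> 2 \<and> arboricity (graph_at S t) \<le> 2}"

definition edge_neighboring :: "nat \<Rightarrow> nat \<Rightarrow> update list \<Rightarrow> update list \<Rightarrow> bool" where
  "edge_neighboring n T S S' \<longleftrightarrow> S \<in> dynamic_streams n T \<and> S' \<in> dynamic_streams n T \<and>
     (\<exists>t<T. (\<forall>i<T. i \<noteq> t \<longrightarrow> S ! i = S' ! i) \<and>
        (S ! t = Bot \<and> S' ! t \<noteq> Bot \<or> S ! t \<noteq> Bot \<and> S' ! t = Bot))"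

section \<open>Mechanisms in the continual release model\<close>

text \<open>
  A mechanism maps a stream to the joint distribution of its outputs, the output at time
  \<open>t \<in> {1..T}\<close> being released after the \<open>t\<close>-th update.
\<close>

type_synonym mechanism = "update list \<Rightarrow> (nat \<Rightarrow> real) measure"

definition output_space :: "nat \<Rightarrow> (nat \<Rightarrow> real) measure" where
  "output_space T = PiM {1..T} (\<lambda>_. borel)"

text \<open>
  The second conjunct expresses that the mechanism is online: the joint law of the outputs up to
  time \<open>t\<close> is determined by the first \<open>t\<close> updates.
\<close>

definition continual_release :: "nat \<Rightarrow> nat \<Rightarrow> mechanism \<Rightarrow> bool" where
  "continual_release n T \<A> \<longleftrightarrow>
     (\<forall>S\<in>dynamic_streams n T. prob_space (\<A> S) \<and> sets (\<A> S) = sets (output_space T)) \<and>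
     (\<forall>S\<in>dynamic_streams n T. \<forall>S'\<in>dynamic_streams n T. \<forall>t\<le>T. take t S = take t S' \<longrightarrow>
        distr (\<A> S) (output_space t) (\<lambda>y. restrict y {1..t}) =
        distr (\<A> S') (output_space t) (\<lambda>y. restrict y {1..t}))"

definition edge_DP :: "real \<Rightarrow> nat \<Rightarrow> nat \<Rightarrow> mechanism \<Rightarrow> bool" where
  "edge_DP \<epsilon> n T \<A> \<longleftrightarrow>
     (\<forall>S S'. edge_neighboring n T S S' \<longrightarrow>
        (\<forall>Y\<in>sets (output_space T). measure (\<A> S) Y \<le> exp \<epsilon> * measure (\<A> S') Y))"

definition components_accurate_on ::
    "update list set \<Rightarrow> nat \<Rightarrow> nat \<Rightarrow> real \<Rightarrow> mechanism \<Rightarrow> bool" where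
  "components_accurate_on \<S> n T \<zeta> \<A> \<longleftrightarrow>
     (\<forall>S\<in>\<S>. measure (\<A> S)
        {y \<in> space (output_space T).
           \<forall>t\<in>{1..T}. \<bar>y t - real (num_components n (graph_at S t))\<bar> \<le> \<zeta>} \<ge> 0.99)"

end

theory Submission imports Defs begin

text \<open>
  Encode \<open>m\<close> secret bits into \<open>m\<close> disjoint four-cycles: two edges of each cycle are always present, a
  third one is present iff the bit is set, and the fourth one is a query edge. A cycle contributes
  one component if its secret or its query edge is present, and two otherwise, so \<open>m\<close> updates of the
  query edges let the component count reveal any prescribed subset sum of the secret. Taking
  \<open>m = 2\<^sup>l\<close> and the \<open>m\<close> subset sums given by a Hadamard matrix \<open>H\<close> costs \<open>n = O(m)\<close> vertices and
  \<open>T = O(m\<^sup>2)\<close> updates. If all answers are \<open>\<zeta>\<close>-accurate then, \<open>H\<close> being \<open>\<surd>m\<close> times an isometry,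
  inverting \<open>H\<close> and rounding recovers all but \<open>36 \<zeta>\<^sup>2\<close> of the bits. Privacy forces every bit to be
  decoded wrongly with constant probability when the secret is uniformly random, hence
  \<open>\<zeta>\<^sup>2 = \<Omega>(m)\<close>.
\<close>

section \<open>Hadamard matrices\<close>

text \<open>Sylvester's construction with blocks H, H, H, -H. The leading binary digits of
  \<open>i\<close> and \<open>j\<close> select the block, so for indices below \<open>2 ^ l\<close>
  the entry is -1 to the number of binary ones that \<open>i\<close> and \<open>j\<close>
  share.\<close>

fun hadamard :: "nat \<Rightarrow> nat \<Rightarrow> nat \<Rightarrow> real" where
  "hadamard 0 i j = 1"
| "hadamard (Suc l) i j =
     (if 2 ^ l \<le> i \<and> 2 ^ l \<le> j then -1 else 1) * hadamard l (i mod 2 ^ l) (j mod 2 ^ l)"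

lemma hadamard_sym: "hadamard l i j = hadamard l j i"
  by (induction l arbitrary: i j) auto

lemma hadamard_cases: "hadamard l i j = 1 \<or> hadamard l i j = -1"
proof (induction l arbitrary: i j)
  case (Suc l)
  then show ?case using Suc[of "i mod 2 ^ l" "j mod 2 ^ l"] by auto
qed auto

text \<open>Since column 0 is all ones, query 0 measures the size of the whole secret. This turns
  subset counts into signed sums.\<close>

lemma hadamard_0_right: "hadamard l i 0 = 1"
  by (induction l arbitrary: i) auto

lemma sum_lessThan_double:
  fixes f :: "nat \<Rightarrow> 'a::comm_monoid_add"
  shows "(\<Sum>j<2 * k. f j) = (\<Sum>j<k. f j) + (\<Sum>j<k. f (j + k))"
proof -
  have "(\<Sum>j<2 * k. f j) = (\<Sum>j=0..<k. f j) + (\<Sum>j=k..<2 * k. f j)"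
    by (simp add: sum.atLeastLessThan_concat lessThan_atLeast0)
  also have "(\<Sum>j=k..<2 * k. f j) = (\<Sum>j=0..<k. f (j + k))"
    using sum.shift_bounds_nat_ivl[of f 0 k k] by (simp add: mult_2)
  finally show ?thesis by (simp add: lessThan_atLeast0)
qed

text \<open>The two halves of the columns contribute the same sum up to the sign
  \<open>?s i * ?s k\<close>. Hence rows from different halves cancel, and rows from the same half
  double the sum given by the induction hypothesis.\<close>

lemma hadamard_orthogonal:
  assumes "i < 2 ^ l" "k < 2 ^ l"
  shows "(\<Sum>j<2 ^ l. hadamard l i j * hadamard l k j) = (if i = k then 2 ^ l else 0)"
  using assms
proof (induction l arbitrary: i k)
  case (Suc l)
  let ?s = "\<lambda>i. if 2 ^ l \<le> i then -1 else 1 :: real"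
  let ?h = "\<lambda>j. hadamard l (i mod 2 ^ l) j * hadamard l (k mod 2 ^ l) j"
  have red: "i mod 2 ^ l = (if 2 ^ l \<le> i then i - 2 ^ l else i)" if "i < 2 ^ Suc l" for i :: nat
    using that by (auto simp: le_mod_geq)
  have "(\<Sum>j<2 ^ Suc l. hadamard (Suc l) i j * hadamard (Suc l) k j)
      = (\<Sum>j<2 ^ l. ?h j) + (\<Sum>j<2 ^ l. ?s i * ?s k * ?h j)"
    unfolding power_Suc sum_lessThan_double
    by (intro arg_cong2[where f = "(+)"] sum.cong) auto
  also have "\<dots> = (1 + ?s i * ?s k) * (\<Sum>j<2 ^ l. ?h j)"
    by (simp add: sum_distrib_left[symmetric] distrib_right)
  also have "\<dots> = (1 + ?s i * ?s k) * (if i mod 2 ^ l = k mod 2 ^ l then 2 ^ l else 0)"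
    by (subst Suc.IH) auto
  also have "\<dots> = (if i = k then 2 ^ Suc l else 0)"
    using red[OF Suc.prems(1)] red[OF Suc.prems(2)] by auto
  finally show ?case .
qed auto

lemma hadamard_inversion:
  assumes "i < 2 ^ l"
  shows "(\<Sum>j<2 ^ l. hadamard l i j * (\<Sum>k<2 ^ l. hadamard l k j * x k)) = 2 ^ l * x i"
proof -
  have "(\<Sum>j<2 ^ l. hadamard l i j * (\<Sum>k<2 ^ l. hadamard l k j * x k))
      = (\<Sum>k<2 ^ l. x k * (\<Sum>j<2 ^ l. hadamard l i j * hadamard l k j))"
    unfolding sum_distrib_left by (subst sum.swap) (simp add: mult_ac)
  also have "\<dots> = (\<Sum>k<2 ^ l. if k = i then 2 ^ l * x i else 0)"
    using assms by (intro sum.cong) (auto simp: hadamard_orthogonal)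
  finally show ?thesis using assms by simp
qed

text \<open>Expanding one factor of each square and swapping the sums leaves H applied twice, which
  by symmetry and inversion is multiplication by \<open>2 ^ l\<close>.\<close>

lemma hadamard_parseval:
  "(\<Sum>i<2 ^ l. (\<Sum>j<2 ^ l. hadamard l i j * e j)\<^sup>2) = 2 ^ l * (\<Sum>j<2 ^ l. (e j)\<^sup>2)"
proof -
  let ?F = "\<lambda>i. \<Sum>j<2 ^ l. hadamard l i j * e j"
  have "(\<Sum>i<2 ^ l. (?F i)\<^sup>2) = (\<Sum>i<2 ^ l. \<Sum>j<2 ^ l. hadamard l i j * e j * ?F i)"
    by (simp add: power2_eq_square sum_distrib_right)
  also have "\<dots> = (\<Sum>j<2 ^ l. e j * (\<Sum>i<2 ^ l. hadamard l j i * ?F i))"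
    by (subst sum.swap) (simp add: sum_distrib_left mult_ac hadamard_sym[of l _ "_ :: nat"])
  also have "\<dots> = (\<Sum>j<2 ^ l. e j * (2 ^ l * e j))"
  proof (intro sum.cong refl)
    fix j :: nat assume "j \<in> {..<2 ^ l}"
    then show "e j * (\<Sum>i<2 ^ l. hadamard l j i * ?F i) = e j * (2 ^ l * e j)"
      using hadamard_inversion[of j l e] by (simp add: hadamard_sym[of l])
  qed
  finally show ?thesis by (simp add: power2_eq_square sum_distrib_left mult_ac)
qed

text \<open>The subsets of \<open>A\<close> split into \<open>2 ^ (card A - 1)\<close> pairs
  \<open>D\<close>, \<open>insert i D\<close>. For a uniformly random secret this averages a bound
  on the two streams that differ only in bit \<open>i\<close>.\<close>

lemma sum_Pow_pairs_ge:
  fixes f :: "'a set \<Rightarrow> real"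
  assumes "finite A" "i \<in> A" and pair: "\<And>D. D \<subseteq> A - {i} \<Longrightarrow> f D + f (insert i D) \<ge> a"
  shows "2 * (\<Sum>D\<in>Pow A. f D) \<ge> a * 2 ^ card A"
proof -
  let ?B = "A - {i}"
  have A: "Pow A = Pow ?B \<union> insert i ` Pow ?B"
    using Pow_insert[of i ?B] assms(2) by (simp add: insert_absorb)
  have inj: "inj_on (insert i) (Pow ?B)" by (auto simp: inj_on_def)
  have "(\<Sum>D\<in>Pow A. f D) = (\<Sum>D\<in>Pow ?B. f D) + (\<Sum>D\<in>insert i ` Pow ?B. f D)"
    unfolding A using assms(1) by (intro sum.union_disjoint) auto
  also have "\<dots> = (\<Sum>D\<in>Pow ?B. f D + f (insert i D))"
    by (simp add: sum.reindex[OF inj] sum.distrib)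
  also have "\<dots> \<ge> (\<Sum>D\<in>Pow ?B. a)" by (intro sum_mono pair) auto
  finally have "(\<Sum>D\<in>Pow A. f D) \<ge> a * 2 ^ card ?B"
    using assms(1) by (simp add: card_Pow mult.commute)
  moreover have "card A = Suc (card ?B)" using assms by (metis card.remove)
  ultimately show ?thesis by simp
qed

section \<open>Reconstruction\<close>

text \<open>By Parseval, inverting H turns errors of size \<open>b\<close> in the
  \<open>2 ^ l\<close> coordinates of \<open>w\<close> into a total squared error of at most
  \<open>b\<^sup>2\<close> in the decoded vector. Each wrongly rounded bit accounts for at least 1/4
  of it.\<close>

lemma hadamard_decoding_error:
  fixes w :: "nat \<Rightarrow> real" and b :: real
  assumes w: "\<And>j. j < 2 ^ l \<Longrightarrow> \<bar>w j - (\<Sum>i<2 ^ l. hadamard l i j * of_bool (i \<in> D))\<bar> \<le> b"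
  shows "card {i. i < 2 ^ l \<and> ((1 / 2 ^ l) * (\<Sum>j<2 ^ l. hadamard l i j * w j) \<ge> 1 / 2) \<noteq> (i \<in> D)} \<le> 4 * b\<^sup>2"
    (is "real (card ?W) \<le> _")
proof -
  define e where "e j = w j - (\<Sum>i<2 ^ l. hadamard l i j * of_bool (i \<in> D))" for j
  define z where "z i = (1 / 2 ^ l) * (\<Sum>j<2 ^ l. hadamard l i j * w j)" for i
  have z: "2 ^ l * (z i - of_bool (i \<in> D)) = (\<Sum>j<2 ^ l. hadamard l i j * e j)" if "i < 2 ^ l" for i
    using hadamard_inversion[OF that, of "\<lambda>i. of_bool (i \<in> D)"]
    by (simp add: z_def e_def right_diff_distrib sum_subtractf)
  have "(2 ^ l)\<^sup>2 * (\<Sum>i<2 ^ l. (z i - of_bool (i \<in> D))\<^sup>2) = (\<Sum>i<2 ^ l. (2 ^ l * (z i - of_bool (i \<in> D)))\<^sup>2)"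
    by (simp only: power_mult_distrib sum_distrib_left)
  also have "\<dots> = (\<Sum>i<2 ^ l. (\<Sum>j<2 ^ l. hadamard l i j * e j)\<^sup>2)"
    by (intro sum.cong) (auto simp only: z lessThan_iff)
  also have "\<dots> = 2 ^ l * (\<Sum>j<2 ^ l. (e j)\<^sup>2)" by (rule hadamard_parseval)
  also have "(\<Sum>j<2 ^ l. (e j)\<^sup>2) \<le> (\<Sum>j<(2::nat) ^ l. b\<^sup>2)"
    using w by (intro sum_mono) (auto simp: e_def intro!: abs_le_square_iff[THEN iffD1] intro: order_trans[OF _ abs_ge_self])
  finally have "(2 ^ l)\<^sup>2 * (\<Sum>i<2 ^ l. (z i - of_bool (i \<in> D))\<^sup>2) \<le> (2 ^ l)\<^sup>2 * b\<^sup>2"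
    by (simp add: power2_eq_square mult_ac)
  then have sq: "(\<Sum>i<2 ^ l. (z i - of_bool (i \<in> D))\<^sup>2) \<le> b\<^sup>2" by simp
  have "card ?W * (1 / 4) = (\<Sum>i\<in>?W. 1 / 4)" by simp
  also have "\<dots> \<le> (\<Sum>i\<in>?W. (z i - of_bool (i \<in> D))\<^sup>2)"
  proof (intro sum_mono)
    fix i assume "i \<in> ?W"
    \<comment> \<open>At a wrong bit the threshold 1/2 separates \<open>z i\<close> from the true
      value 0 or 1, or \<open>z i\<close> equals it.\<close>
    then have "\<bar>1 / 2\<bar> \<le> \<bar>z i - of_bool (i \<in> D)\<bar>" unfolding z_def[symmetric] by auto
    then have "(1 / 2)\<^sup>2 \<le> (z i - of_bool (i \<in> D))\<^sup>2" unfolding abs_le_square_iff .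
    then show "1 / 4 \<le> (z i - of_bool (i \<in> D))\<^sup>2" by (simp add: power2_eq_square)
  qed
  also have "\<dots> \<le> (\<Sum>i<2 ^ l. (z i - of_bool (i \<in> D))\<^sup>2)"
    by (intro sum_mono2) auto
  finally show ?thesis using sq by simp
qed

text \<open>The left side is the expected number of events \<open>W i\<close> that occur. This
  number is at most \<open>b\<close> on \<open>A\<close> and at most \<open>card I\<close>
  elsewhere.\<close>

lemma (in prob_space) sum_prob_le:
  assumes "finite I" and W: "\<And>i. i \<in> I \<Longrightarrow> W i \<in> events" and A: "A \<in> events"
    and b: "\<And>y. y \<in> A \<Longrightarrow> real (card {i\<in>I. y \<in> W i}) \<le> b" "b \<ge> 0"
  shows "(\<Sum>i\<in>I. prob (W i)) \<le> b + card I * (1 - prob A)"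
proof -
  have "(\<Sum>i\<in>I. prob (W i)) = expectation (\<lambda>y. \<Sum>i\<in>I. indicator (W i) y)"
    using W by (subst Bochner_Integration.integral_sum) (auto simp: integrable_indicator_iff less_top[symmetric])
  also have "\<dots> \<le> expectation (\<lambda>y. b + card I * indicat_real (space M - A) y)"
  proof (intro integral_mono)
    fix y assume y: "y \<in> space M"
    have "(\<Sum>i\<in>I. indicat_real (W i) y) = real (card {i\<in>I. y \<in> W i})"
      using \<open>finite I\<close> by (simp add: indicator_def of_bool_def sum.If_cases Int_def)
    moreover have "card {i\<in>I. y \<in> W i} \<le> card I" using \<open>finite I\<close> by (intro card_mono) auto
    ultimately show "(\<Sum>i\<in>I. indicator (W i) y) \<le> b + card I * indicat_real (space M - A) y"
      using b(1)[of y] b(2) y by (cases "y \<in> A") auto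
  qed (use W A in \<open>auto intro!: Bochner_Integration.integrable_sum Bochner_Integration.integrable_add integrable_mult_right simp: integrable_indicator_iff less_top[symmetric]\<close>)
  also have "\<dots> = b + card I * prob (space M - A)"
    using A by (subst Bochner_Integration.integral_add)
      (auto simp: prob_space integrable_indicator_iff less_top[symmetric])
  finally show ?thesis using A by (simp add: prob_compl)
qed

lemma reconstruction_lower_bound:
  fixes \<A> :: mechanism and S :: "nat set \<Rightarrow> update list" and C :: "nat \<Rightarrow> real" and \<tau> :: "nat \<Rightarrow> nat"
  assumes rel: "continual_release n T \<A>" and dp: "edge_DP 1 n T \<A>" and "\<zeta> \<ge> 0"
    and acc: "components_accurate_on \<S> n T \<zeta> \<A>" and "\<S> \<subseteq> dynamic_streams n T"
    and S: "\<And>D. D \<subseteq> {..<2 ^ l} \<Longrightarrow> S D \<in> \<S>"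
    and nbr: "\<And>i D. i < 2 ^ l \<Longrightarrow> D \<subseteq> {..<2 ^ l} - {i} \<Longrightarrow> edge_neighboring n T (S (insert i D)) (S D)"
    and \<tau>: "\<And>j. j < 2 ^ l \<Longrightarrow> \<tau> j \<in> {1..T}"
    and cnt: "\<And>j D. j < 2 ^ l \<Longrightarrow> D \<subseteq> {..<2 ^ l} \<Longrightarrow>
       real (num_components n (graph_at (S D) (\<tau> j))) = C j - card {i\<in>D. hadamard l i j = 1}"
  shows "2 ^ l \<le> 240 * \<zeta>\<^sup>2"
proof -
  define m :: nat where "m = 2 ^ l"
  define \<Omega> where "\<Omega> = output_space T"
  \<comment> \<open>\<open>C j - y (\<tau> j)\<close> estimates the number of secret elements with
    entry +1 in column \<open>j\<close>, and \<open>C 0 - y (\<tau> 0)\<close> estimates the size of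
    the secret. Twice the former minus the latter estimates the signed sum over column
    \<open>j\<close>, with error at most 2\<zeta> + \<zeta>.\<close>
  define w where "w j y = 2 * (C j - y (\<tau> j)) - (C 0 - y (\<tau> 0))" for j and y :: "nat \<Rightarrow> real"
  define z where "z i y = (1 / 2 ^ l) * (\<Sum>j<2 ^ l. hadamard l i j * w j y)" for i and y :: "nat \<Rightarrow> real"
  define W where "W i D = {y\<in>space \<Omega>. (z i y \<ge> 1 / 2) \<noteq> (i \<in> D)}" for i D
  define G where "G D = {y \<in> space \<Omega>.
           \<forall>t\<in>{1..T}. \<bar>y t - real (num_components n (graph_at (S D) t))\<bar> \<le> \<zeta>}" for D
  have meas_y: "(\<lambda>y. y (\<tau> j)) \<in> borel_measurable \<Omega>" if "j < 2 ^ l" for j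
    unfolding \<Omega>_def output_space_def using \<tau>[OF that] by (rule measurable_component_singleton)
  have [measurable]: "z i \<in> borel_measurable \<Omega>" for i
    unfolding z_def w_def using meas_y
    by (intro borel_measurable_times borel_measurable_sum borel_measurable_diff borel_measurable_const) auto
  have W_sets: "W i D \<in> sets \<Omega>" for i D unfolding W_def by measurable
  have M: "prob_space (\<A> (S D))" "sets (\<A> (S D)) = sets \<Omega>" "space (\<A> (S D)) = space \<Omega>"
    if "D \<subseteq> {..<m}" for D
    using rel S[of D] assms(5) that sets_eq_imp_space_eq[of "\<A> (S D)" \<Omega>]
    by (auto simp: continual_release_def m_def \<Omega>_def)
  have meas_t: "(\<lambda>y. y t) \<in> borel_measurable \<Omega>" if "t \<in> {1..T}" for t
    unfolding \<Omega>_def output_space_def using that by (rule measurable_component_singleton)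
  have G_sets: "G D \<in> sets \<Omega>" for D
    unfolding G_def
    by (intro sets.sets_Collect_finite_All borel_measurable_le borel_measurable_abs borel_measurable_diff
         borel_measurable_const meas_t) auto
  \<comment> \<open>Here 36 is 4 times the square of 3, from decoding with error 3\<zeta>. The last
    summand allows all \<open>m\<close> bits to be wrong with the failure probability 0.01.\<close>
  have wrong: "(\<Sum>i<m. measure (\<A> (S D)) (W i D)) \<le> 36 * \<zeta>\<^sup>2 + m * 0.01" if D: "D \<subseteq> {..<m}" for D
  proof -
    interpret prob_space "\<A> (S D)" using M(1)[OF D] .
    have "card {i\<in>{..<m}. y \<in> W i D} \<le> 36 * \<zeta>\<^sup>2" if y: "y \<in> G D" for y
    proof -
      have fin: "finite D" using D finite_subset by blast
      have "\<bar>w j y - (\<Sum>i<2 ^ l. hadamard l i j * of_bool (i \<in> D))\<bar> \<le> 3 * \<zeta>" if j: "j < 2 ^ l" for j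
      proof -
        let ?P = "{i\<in>D. hadamard l i j = 1}"
        have "(\<Sum>i<2 ^ l. hadamard l i j * of_bool (i \<in> D)) = (\<Sum>i\<in>D. hadamard l i j)"
          using D by (intro sum.mono_neutral_cong_right) (auto simp: m_def)
        also have "\<dots> = (\<Sum>i\<in>D. 2 * of_bool (hadamard l i j = 1) - 1)"
          using hadamard_cases by (intro sum.cong) fastforce+
        also have "\<dots> = 2 * real (card ?P) - real (card D)"
          using fin by (simp add: sum_subtractf sum_distrib_left[symmetric] of_bool_def sum.If_cases Int_def)
        finally have *: "(\<Sum>i<2 ^ l. hadamard l i j * of_bool (i \<in> D)) = 2 * real (card ?P) - real (card D)" .
        have "\<bar>y (\<tau> j) - (C j - card ?P)\<bar> \<le> \<zeta>"
          using y \<tau>[OF j] cnt[OF j] D unfolding G_def m_def by fastforce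
        moreover have "\<bar>y (\<tau> 0) - (C 0 - card D)\<bar> \<le> \<zeta>"
          using y \<tau>[of 0] cnt[of 0 D] D unfolding G_def m_def by (fastforce simp: hadamard_0_right)
        moreover have "\<bar>2 * (c - p) - (d - q) - (2 * a - b)\<bar> \<le> 3 * \<zeta>"
          if "\<bar>p - (c - a)\<bar> \<le> \<zeta>" "\<bar>q - (d - b)\<bar> \<le> \<zeta>" for a b c d p q :: real
          using that by (smt (verit))
        ultimately show ?thesis unfolding * w_def by blast
      qed
      from hadamard_decoding_error[OF this]
      have "card {i. i < 2 ^ l \<and> (z i y \<ge> 1 / 2) \<noteq> (i \<in> D)} \<le> 4 * (3 * \<zeta>)\<^sup>2" unfolding z_def .
      moreover have "{i\<in>{..<m}. y \<in> W i D} = {i. i < 2 ^ l \<and> (z i y \<ge> 1 / 2) \<noteq> (i \<in> D)}"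
        using y by (auto simp: W_def G_def m_def)
      ultimately show ?thesis by (simp add: power_mult_distrib)
    qed
    then have "(\<Sum>i<m. prob (W i D)) \<le> 36 * \<zeta>\<^sup>2 + card {..<m} * (1 - prob (G D))"
      using W_sets G_sets by (intro sum_prob_le) (auto simp: M[OF D])
    also have "prob (G D) \<ge> 0.99"
      using acc S[of D] D unfolding components_accurate_on_def G_def \<Omega>_def m_def by blast
    then have "36 * \<zeta>\<^sup>2 + card {..<m} * (1 - prob (G D)) \<le> 36 * \<zeta>\<^sup>2 + m * 0.01"
      using mult_left_mono[of "1 - prob (G D)" "0.01" "real m"] by simp
    finally show ?thesis .
  qed
  \<comment> \<open>The two error events at bit \<open>i\<close> are complementary. If
    \<open>W i D\<close> has probability p under \<open>D\<close> and q under
    \<open>insert i D\<close>, then privacy gives q \<le> 3p, so the sum p + 1 - q is at least 1 -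
    2q/3 \<ge> 1/3.\<close>
  have bit_error: "measure (\<A> (S D)) (W i D) + measure (\<A> (S (insert i D))) (W i (insert i D)) \<ge> 1 / 3"
    if i: "i < m" and D: "D \<subseteq> {..<m} - {i}" for i D
  proof -
    let ?P = "\<lambda>D. measure (\<A> (S D))"
    have D': "insert i D \<subseteq> {..<m}" "D \<subseteq> {..<m}" using i D by auto
    interpret prob_space "\<A> (S (insert i D))" using M(1)[OF D'(1)] .
    have "W i (insert i D) = space \<Omega> - W i D" using D by (auto simp: W_def)
    then have "?P (insert i D) (W i (insert i D)) = 1 - ?P (insert i D) (W i D)"
      using prob_compl[of "W i D"] W_sets by (simp add: M[OF D'(1)])
    moreover have "?P (insert i D) (W i D) \<le> exp 1 * ?P D (W i D)"
      using dp nbr[of i D] i D W_sets unfolding edge_DP_def \<Omega>_def m_def by blast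
    moreover have "exp 1 * ?P D (W i D) \<le> 3 * ?P D (W i D)"
      using exp_le by (intro mult_right_mono) auto
    moreover have "?P (insert i D) (W i D) \<le> 1" by simp
    ultimately show ?thesis by linarith
  qed
  \<comment> \<open>The error probabilities are summed over all bits and all \<open>2 ^ m\<close>
    secrets: privacy bounds the sum from below bit by bit, accuracy from above secret by
    secret.\<close>
  have "real m * (1 / 3 * 2 ^ m) \<le> (\<Sum>i<m. 2 * (\<Sum>D\<in>Pow {..<m}. measure (\<A> (S D)) (W i D)))"
  proof -
    have "1 / 3 * 2 ^ card {..<m} \<le> 2 * (\<Sum>D\<in>Pow {..<m}. measure (\<A> (S D)) (W i D))" if "i < m" for i
      using that bit_error by (intro sum_Pow_pairs_ge) auto
    from sum_mono[of "{..<m}", OF this] show ?thesis by simp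
  qed
  also have "\<dots> = 2 * (\<Sum>D\<in>Pow {..<m}. \<Sum>i<m. measure (\<A> (S D)) (W i D))"
    by (subst sum.swap) (simp add: sum_distrib_left)
  also have "\<dots> \<le> 2 * (\<Sum>D\<in>Pow {..<m}. 36 * \<zeta>\<^sup>2 + m * 0.01)"
    using wrong by (intro mult_left_mono sum_mono) auto
  also have "\<dots> = 2 ^ m * (2 * (36 * \<zeta>\<^sup>2 + m * 0.01))" by (simp add: card_Pow)
  finally have "2 ^ m * (m / 3) \<le> 2 ^ m * (2 * (36 * \<zeta>\<^sup>2 + m * 0.01))" by (simp add: mult_ac)
  then have "m / 3 \<le> 2 * (36 * \<zeta>\<^sup>2 + m * 0.01)" by (subst (asm) mult_le_cancel_left_pos) auto
  \<comment> \<open>The inequality gives (1/3 - 0.02) m \<le> 72 \<zeta>^2, and 72 / (1/3 - 0.02) is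
    just below 230.\<close>
  then have "real m \<le> 240 * \<zeta>\<^sup>2" by simp
  then show ?thesis by (simp add: m_def)
qed

section \<open>Disjoint four-cycles\<close>

text \<open>The index \<open>k\<close> runs around the cycle and fixes the role of the edge: 0 and 1
  are always present after setup, 2 is the query edge, 3 the secret edge. The last two are the edges
  at the vertex \<open>4 * i + 3\<close>.\<close>

definition link :: "nat \<Rightarrow> nat \<Rightarrow> edge" where
  "link i k = {4 * i + k, 4 * i + Suc k mod 4}"

definition cycle_edges :: "nat \<Rightarrow> edge set" where
  "cycle_edges m = (\<Union>i<m. link i ` {..<4})"

lemma less_4_cases: "k < (4::nat) \<Longrightarrow> k = 0 \<or> k = 1 \<or> k = 2 \<or> k = 3" by auto

lemma link_simps:
  "link i 0 = {4 * i, 4 * i + 1}" "link i 1 = {4 * i + 1, 4 * i + 2}"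
  "link i 2 = {4 * i + 2, 4 * i + 3}" "link i 3 = {4 * i + 3, 4 * i}"
  by (auto simp: link_def)

lemma link_inject:
  assumes "k < 4" "k' < 4"
  shows "link i k = link i' k' \<longleftrightarrow> i = i' \<and> k = k'"
  using less_4_cases[OF assms(1)] less_4_cases[OF assms(2)]
  by (elim disjE; simp only: link_simps doubleton_eq_iff; presburger)

lemma link_in_edges_on:
  assumes "k < 4" "4 * i + 3 < n"
  shows "link i k \<in> edges_on n"
  using less_4_cases[OF assms(1)] assms(2)
  by (elim disjE) (auto simp: link_simps edges_on_def card_insert_if simp del: One_nat_def)

lemma cycle_edges_subset:
  assumes "4 * m \<le> n"
  shows "cycle_edges m \<subseteq> edges_on n"
  using assms by (auto simp: cycle_edges_def intro!: link_in_edges_on)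

lemma bipartite_cycle_edges:
  assumes "E \<subseteq> cycle_edges m" "4 * m \<le> n"
  shows "bipartite n E"
proof -
  let ?A = "{v. v < n \<and> even v}" and ?B = "{v. v < n \<and> odd v}"
  have "\<exists>a\<in>?A. \<exists>b\<in>?B. e = {a, b}" if "e \<in> E" for e
  proof -
    have "e \<in> cycle_edges m" using that assms(1) by blast
    then obtain i k where ik: "i < m" "k < 4" "e = link i k" by (auto simp: cycle_edges_def)
    \<comment> \<open>The even and the odd endpoint of \<open>link i k\<close>; vertices alternate
      in parity around the cycle.\<close>
    let ?a = "4 * i + 2 * (Suc k div 2 mod 2)" and ?b = "4 * i + (if k < 2 then 1 else 3)"
    have "e = {?a, ?b}" using less_4_cases[OF ik(2)] ik(3) by (auto simp: link_def)
    moreover have "?a \<in> ?A" "?b \<in> ?B" using ik(1) assms(2) by auto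
    ultimately show ?thesis by blast
  qed
  moreover have "?A \<union> ?B = {..<n}" "?A \<inter> ?B = {}" by auto
  ultimately show ?thesis unfolding bipartite_def by blast
qed

lemma max_degree_cycle_edges:
  assumes "E \<subseteq> cycle_edges m" "n > 0"
  shows "max_degree n E \<le> 2"
proof -
  have "vertex_degree E v \<le> 2" for v
  proof -
    \<comment> \<open>Adding 3 modulo 4 steps back by one: a vertex lies only on the link that
      starts at it and on the preceding one.\<close>
    let ?F = "{link (v div 4) (v mod 4), link (v div 4) ((v mod 4 + 3) mod 4)}"
    have "{e \<in> E. v \<in> e} \<subseteq> ?F"
    proof
      fix e assume e: "e \<in> {e \<in> E. v \<in> e}"
      then obtain i k where ik: "i < m" "k < 4" "e = link i k"
        using assms(1) by (auto simp: cycle_edges_def)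
      obtain k' where k': "v = 4 * i + k'" "k' < 4" "k' = k \<or> k' = Suc k mod 4"
        using e ik(2,3) by (auto simp: link_def)
      have "v div 4 = i" "v mod 4 = k'" using k'(1,2) by auto
      moreover have "k = k' \<or> k = (k' + 3) mod 4" using k'(3) less_4_cases[OF ik(2)] by auto
      ultimately show "e \<in> ?F" unfolding ik(3) by auto
    qed
    then have "card {e \<in> E. v \<in> e} \<le> card ?F" by (intro card_mono) auto
    also have "\<dots> \<le> 2" by (simp add: card_insert_if)
    finally show ?thesis unfolding vertex_degree_def .
  qed
  then show ?thesis using assms(2) unfolding max_degree_def by (intro Max.boundedI) auto
qed

text \<open>The assumption makes \<open>F\<close> a matching, whereas a cycle of length at least 3
  has two different edges at \<open>vs ! 1\<close>.\<close>

lemma forest_if_edge_determined_by_vertex: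
  assumes "\<And>e v. e \<in> F \<Longrightarrow> v \<in> e \<Longrightarrow> e = f v"
  shows "forest F"
  unfolding forest_def
proof
  assume "\<exists>vs. is_cycle F vs"
  then obtain vs where vs: "is_cycle F vs" ..
  then have len: "3 \<le> length vs" and "distinct vs" by (auto simp: is_cycle_def)
  have "{vs ! i, vs ! (Suc i mod length vs)} \<in> F" if "i < length vs" for i
    using vs that unfolding is_cycle_def by blast
  from this[of 0] this[of 1]
  have "{vs ! 0, vs ! 1} \<in> F" "{vs ! 1, vs ! 2} \<in> F"
    using len by (force simp: numeral_2_eq_2)+
  then have "{vs ! 0, vs ! 1} = {vs ! 1, vs ! 2}" using assms[of _ "vs ! 1"] by blast
  then have "vs ! 0 = vs ! 2 \<or> vs ! 0 = vs ! 1" by (auto simp: doubleton_eq_iff)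
  moreover have "vs ! 0 \<noteq> vs ! 2" "vs ! 0 \<noteq> vs ! 1"
    using len \<open>distinct vs\<close> by (subst nth_eq_iff_index_eq; force)+
  ultimately show False by blast
qed

text \<open>Opposite edges of a four-cycle are disjoint, so the even links and the odd links form
  two matchings, each of which is a forest.\<close>

lemma arboricity_cycle_edges:
  assumes "E \<subseteq> cycle_edges m"
  shows "arboricity E \<le> 2"
proof -
  define M where "M = {e. \<exists>i. e = link i 0 \<or> e = link i 2}"
  let ?F = "\<lambda>i::nat. if i = 0 then E \<inter> M else E - M"
  have "forest (E \<inter> M)"
    by (rule forest_if_edge_determined_by_vertex[where
          f = "\<lambda>v. link (v div 4) (if v mod 4 < 2 then 0 else 2)"])
      (auto simp: M_def link_simps simp del: add_2_eq_Suc')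
  moreover have "forest (E - M)"
  proof (rule forest_if_edge_determined_by_vertex[where
        f = "\<lambda>v. link (v div 4) (if v mod 4 \<in> {1, 2} then 1 else 3)"])
    fix e v assume e: "e \<in> E - M" "v \<in> e"
    have "e \<in> cycle_edges m" using e(1) assms by blast
    then obtain i k where ik: "k < 4" "e = link i k" by (auto simp: cycle_edges_def)
    then have "k = 1 \<or> k = 3" using e(1) less_4_cases by (auto simp: M_def)
    then show "e = link (v div 4) (if v mod 4 \<in> {1, 2} then 1 else 3)"
      using e(2) ik(2) by (auto simp: link_simps simp del: add_2_eq_Suc' One_nat_def)
  qed
  ultimately have "E = (\<Union>i<2. ?F i) \<and> disjoint_family_on ?F {..<2} \<and> (\<forall>i<2. forest (?F i))"
    by (auto simp: disjoint_family_on_def less_2_cases_iff)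
  then show ?thesis unfolding arboricity_def by (intro Least_le) blast
qed

lemma fold_apply_update_subset:
  assumes "set us \<subseteq> Insertion ` G \<union> Deletion ` G \<union> {Bot}" "E \<subseteq> G"
  shows "fold apply_update us E \<subseteq> G"
  using assms
proof (induction us arbitrary: E)
  case (Cons u us)
  have "apply_update u E \<subseteq> G" using Cons.prems by auto
  then show ?case using Cons by auto
qed auto

text \<open>Every intermediate graph of such a stream is a subgraph of the disjoint four-cycles,
  which settles all three structural restrictions at once.\<close>

lemma restricted_streams_cycle_edges:
  assumes "4 * m \<le> n" "0 < n" "length S = T"
    and S: "set S \<subseteq> Insertion ` cycle_edges m \<union> Deletion ` cycle_edges m \<union> {Bot}"
  shows "S \<in> restricted_streams n T"
proof -
  have "graph_at S t \<subseteq> cycle_edges m" for t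
    unfolding graph_at_def using S by (intro fold_apply_update_subset) (auto dest: in_set_takeD)
  moreover have "S \<in> dynamic_streams n T"
    using S cycle_edges_subset[OF assms(1)] assms(3) by (force simp: dynamic_streams_def updates_def)
  ultimately show ?thesis
    unfolding restricted_streams_def using assms(1,2)
    by (intro CollectI conjI ballI bipartite_cycle_edges[of _ m] max_degree_cycle_edges[of _ m]
      arboricity_cycle_edges[of _ m]) auto
qed

section \<open>Counting components\<close>

text \<open>The map \<open>r\<close> picks a representative of each component: being constant along
  edges it cannot merge too little, and being connected to its argument it cannot merge too much.
  Its fibres are therefore the components.\<close>

lemma num_components_eq_card_image:
  assumes inv: "\<And>u v. {u, v} \<in> E \<Longrightarrow> r u = r v"
    and conn: "\<And>v. v < n \<Longrightarrow> (v, r v) \<in> {(u, v). {u, v} \<in> E}\<^sup>*"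
  shows "num_components n E = card (r ` {..<n})"
proof -
  let ?R = "{(u, v). {u, v} \<in> E}"
  have "sym ?R" by (auto simp: sym_def insert_commute)
  then have sym: "sym (?R\<^sup>*)" by (rule sym_rtrancl)
  have "r u = r v" if "(u, v) \<in> ?R\<^sup>*" for u v
    using that by induction (auto dest: inv)
  moreover have "(u, v) \<in> ?R\<^sup>*" if "u < n" "v < n" "r u = r v" for u v
    using rtrancl_trans[OF conn[OF that(1)]] symD[OF sym conn[OF that(2)]] that(3) by simp
  ultimately have c: "connectivity n E = {(u, v). u < n \<and> v < n \<and> r u = r v}"
    unfolding connectivity_def by auto
  have "connectivity n E `` {u} = {v. v < n \<and> r v = r u}" if "u < n" for u
    using that by (auto simp: c)
  then have "{..<n} // connectivity n E = (\<lambda>a. {v. v < n \<and> r v = a}) ` r ` {..<n}"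
    by (auto simp: quotient_def)
  moreover have "inj_on (\<lambda>a. {v. v < n \<and> r v = a}) (r ` {..<n})"
    by (auto simp: inj_on_def)
  ultimately show ?thesis unfolding num_components_def by (simp add: card_image)
qed

lemma num_components_single_edge:
  assumes "u < n" "v < n" "u \<noteq> v"
  shows "num_components n {{u, v}} = n - 1"
proof -
  have "num_components n {{u, v}} = card ((\<lambda>x. if x = v then u else x) ` {..<n})"
    by (intro num_components_eq_card_image) (auto simp: doubleton_eq_iff insert_commute)
  also have "(\<lambda>x. if x = v then u else x) ` {..<n} = {..<n} - {v}"
    using assms by auto
  finally show ?thesis using assms by simp
qed

lemma num_components_empty: "num_components n {} = n"
  by (subst num_components_eq_card_image[where r = id]) auto

definition encoding_graph :: "nat \<Rightarrow> nat set \<Rightarrow> nat set \<Rightarrow> edge set" where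
  "encoding_graph m D Q =
     (\<lambda>i. link i 0) ` {..<m} \<union> (\<lambda>i. link i 1) ` {..<m} \<union> (\<lambda>i. link i 2) ` Q \<union> (\<lambda>i. link i 3) ` D"

text \<open>Each cycle loses two components to its fixed path, and a third one if its last vertex is
  attached by the secret or the query edge. Having both edges only closes the cycle, hence the
  union.\<close>

lemma num_components_encoding_graph:
  assumes "4 * m \<le> n" "D \<subseteq> {..<m}" "Q \<subseteq> {..<m}"
  shows "num_components n (encoding_graph m D Q) = n - (2 * m + card (D \<union> Q))"
proof -
  let ?E = "encoding_graph m D Q"
  let ?R = "{(u, v). {u, v} \<in> ?E}"
  \<comment> \<open>The vertex \<open>4 * i\<close> represents everything attached to it. All
    remaining vertices are isolated and represent themselves, so \<open>?N\<close> below consists of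
    the vertices that are not representatives.\<close>
  define r where "r v = (if v < 4 * m \<and> (v mod 4 < 3 \<or> v div 4 \<in> D \<union> Q) then 4 * (v div 4) else v)" for v
  let ?N = "(\<lambda>i. 4 * i + 1) ` {..<m} \<union> (\<lambda>i. 4 * i + 2) ` {..<m} \<union> (\<lambda>i. 4 * i + 3) ` (D \<union> Q)"
  have r_add: "r (4 * i + k) = (if k < 3 \<or> i \<in> D \<union> Q then 4 * i else 4 * i + k)"
    if "i < m" "k < 4" for i k
  proof -
    have "4 * i + k < 4 * m" "(4 * i + k) div 4 = i" "(4 * i + k) mod 4 = k" using that by auto
    then show ?thesis unfolding r_def by simp
  qed
  have r_link: "r (4 * i) = 4 * i" "r (4 * i + 1) = 4 * i" "r (4 * i + 2) = 4 * i"
    "i \<in> D \<union> Q \<Longrightarrow> r (4 * i + 3) = 4 * i" if "i < m" for i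
    using r_add[OF that, of 0] r_add[OF that, of 1] r_add[OF that, of 2] r_add[OF that, of 3]
    by simp_all
  have inv: "r u = r v" if uv: "{u, v} \<in> ?E" for u v
  proof -
    obtain i where "i < m" "{u, v} = link i 0 \<or> {u, v} = link i 1 \<or>
        {u, v} = link i 2 \<and> i \<in> Q \<or> {u, v} = link i 3 \<and> i \<in> D"
      using uv assms(2,3) unfolding encoding_graph_def by blast
    then show ?thesis using r_link[of i] unfolding link_simps doubleton_eq_iff by auto
  qed
  have conn: "(v, r v) \<in> ?R\<^sup>*" for v
  proof (cases "r v = v")
    case False
    define i where "i = v div 4"
    have i: "i < m" "r v = 4 * i" "v mod 4 < 3 \<or> i \<in> D \<union> Q"
      using False by (auto simp: r_def i_def split: if_splits)
    have 1: "(4 * i + 1, 4 * i) \<in> ?R" and 2: "(4 * i + 2, 4 * i + 1) \<in> ?R"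
      using i(1) link_simps(1,2)[of i] by (auto simp: encoding_graph_def insert_commute)
    have 3: "(4 * i + 3, 4 * i + 2) \<in> ?R \<or> (4 * i + 3, 4 * i) \<in> ?R" if "i \<in> D \<union> Q"
      using that link_simps(3,4)[of i] by (auto simp: encoding_graph_def insert_commute)
    have R1: "(4 * i + 1, 4 * i) \<in> ?R\<^sup>*" using 1 by (rule r_into_rtrancl)
    have R2: "(4 * i + 2, 4 * i) \<in> ?R\<^sup>*" using 2 R1 by (rule converse_rtrancl_into_rtrancl)
    have R3: "(4 * i + 3, 4 * i) \<in> ?R\<^sup>*" if "i \<in> D \<union> Q"
      using 3[OF that] R2 by (auto intro: converse_rtrancl_into_rtrancl r_into_rtrancl)
    have "(4 * i + k, 4 * i) \<in> ?R\<^sup>*" if "k < 4" "k < 3 \<or> i \<in> D \<union> Q" for k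
      using less_4_cases[OF that(1)] that(2) R1 R2 R3 by (elim disjE) auto
    from this[of "v mod 4"] show ?thesis using i by (simp add: i_def)
  qed auto
  have "r ` {..<n} = {..<n} - ?N"
  proof (intro equalityI subsetI)
    fix x assume "x \<in> r ` {..<n}"
    then obtain v where v: "v < n" "x = r v" by auto
    show "x \<in> {..<n} - ?N"
    proof (cases "v < 4 * m \<and> (v mod 4 < 3 \<or> v div 4 \<in> D \<union> Q)")
      case True
      then have "x = 4 * (v div 4)" using v by (simp add: r_def)
      moreover have "4 * (v div 4) < n" using v(1) by linarith
      moreover have "4 * a \<noteq> 4 * b + 1" "4 * a \<noteq> 4 * b + 2" "4 * a \<noteq> 4 * b + 3" for a b :: nat
        by presburger+
      ultimately show ?thesis by auto
    next
      case False
      have "4 * i + k \<noteq> v" if "i < m" "k < 4" "k < 3 \<or> i \<in> D \<union> Q" for i k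
      proof
        assume "4 * i + k = v"
        then have "v < 4 * m" "v mod 4 = k" "v div 4 = i" using that(1,2) by auto
        then show False using False that(3) by simp
      qed
      from this[of _ 1] this[of _ 2] this[of _ 3] have "v \<notin> ?N" using assms(2,3) by fastforce
      moreover have "x = v" using False unfolding v(2) r_def by (rule if_not_P)
      ultimately show ?thesis using v(1) by blast
    qed
  next
    fix x assume x: "x \<in> {..<n} - ?N"
    have "r x = x"
    proof (cases "x < 4 * m \<and> (x mod 4 < 3 \<or> x div 4 \<in> D \<union> Q)")
      case True
      define i where "i = x div 4"
      have i: "i < m" "x mod 4 < 3 \<or> i \<in> D \<union> Q" using True by (auto simp: i_def)
      have "4 * i + k \<in> ?N" if "k < 4" "k \<noteq> 0" "k < 3 \<or> i \<in> D \<union> Q" for k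
        using less_4_cases[OF that(1)] that(2,3) i(1) by (elim disjE) auto
      from this[of "x mod 4"] have "x mod 4 = 0" using x i(2) by (auto simp: i_def)
      then show ?thesis using True by (auto simp: r_def)
    next
      case False
      then show ?thesis unfolding r_def by (rule if_not_P)
    qed
    then show "x \<in> r ` {..<n}" using x by (metis DiffD1 imageI)
  qed
  moreover have "card ?N = 2 * m + card (D \<union> Q)"
  proof -
    have fin: "finite (D \<union> Q)" using assms finite_subset by blast
    have "card ?N = card ((\<lambda>i. 4 * i + 1) ` {..<m} \<union> (\<lambda>i. 4 * i + 2) ` {..<m}) + card ((\<lambda>i. 4 * i + 3) ` (D \<union> Q))"
      using fin by (intro card_Un_disjoint finite_UnI finite_imageI finite_lessThan) (auto, presburger+)
    also have "card ((\<lambda>i. 4 * i + 1) ` {..<m} \<union> (\<lambda>i::nat. 4 * i + 2) ` {..<m}) =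
       card ((\<lambda>i::nat. 4 * i + 1) ` {..<m}) + card ((\<lambda>i::nat. 4 * i + 2) ` {..<m})"
      by (intro card_Un_disjoint) (auto, presburger+)
    finally show ?thesis by (simp add: card_image inj_on_def)
  qed
  moreover have "?N \<subseteq> {..<n}" using assms by auto
  ultimately show ?thesis
    using num_components_eq_card_image[of ?E r n, OF inv conn]
      card_Diff_subset[of ?N "{..<n}", OF finite_subset] by (metis card_lessThan finite_lessThan)
qed

section \<open>The encoding stream\<close>

text \<open>A zero bit is written as \<open>Bot\<close>, not as a deletion, so that flipping it
  changes one timestep between \<open>Bot\<close> and an update, as edge-neighboring
  demands.\<close>

definition data_block :: "nat \<Rightarrow> nat set \<Rightarrow> update list" where
  "data_block m D = map (\<lambda>i. if i \<in> D then Insertion (link i 3) else Bot) [0..<m]"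

definition path_block :: "nat \<Rightarrow> update list" where
  "path_block m = map (\<lambda>i. Insertion (link i 0)) [0..<m] @ map (\<lambda>i. Insertion (link i 1)) [0..<m]"

text \<open>Every query edge is set explicitly, so a block overwrites the previous query whatever it
  was, takes exactly \<open>m\<close> updates and does not depend on the secret.\<close>

definition query_block :: "nat \<Rightarrow> nat set \<Rightarrow> update list" where
  "query_block m Q = map (\<lambda>i. if i \<in> Q then Insertion (link i 2) else Deletion (link i 2)) [0..<m]"

definition query_blocks :: "nat \<Rightarrow> (nat \<Rightarrow> nat set) \<Rightarrow> nat \<Rightarrow> nat \<Rightarrow> update list" where
  "query_blocks m Q a b = concat (map (\<lambda>j. query_block m (Q j)) [a..<b])"

lemma length_blocks [simp]:
  "length (data_block m D) = m" "length (path_block m) = 2 * m" "length (query_block m Q') = m"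
  "length (query_blocks m Q a b) = (b - a) * m"
proof -
  show q: "length (query_block m Q') = m" for Q' by (simp add: query_block_def)
  show "length (query_blocks m Q a b) = (b - a) * m"
    by (simp add: query_blocks_def length_concat comp_def q sum_list_triv)
qed (simp_all add: data_block_def path_block_def)

lemma set_blocks:
  "set (data_block m D) \<subseteq> Insertion ` cycle_edges m \<union> {Bot}"
  "set (path_block m) \<subseteq> Insertion ` cycle_edges m"
  "set (query_blocks m Q a b) \<subseteq> Insertion ` cycle_edges m \<union> Deletion ` cycle_edges m"
proof -
  have link: "link i k \<in> cycle_edges m" if "i < m" "k < 4" for i k
    using that unfolding cycle_edges_def by blast
  show "set (data_block m D) \<subseteq> Insertion ` cycle_edges m \<union> {Bot}"
    "set (path_block m) \<subseteq> Insertion ` cycle_edges m"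
    by (auto simp: data_block_def path_block_def intro!: link imageI)
  have "set (query_block m Q') \<subseteq> Insertion ` cycle_edges m \<union> Deletion ` cycle_edges m" for Q'
    by (auto simp: query_block_def intro!: link imageI)
  then show "set (query_blocks m Q a b) \<subseteq> Insertion ` cycle_edges m \<union> Deletion ` cycle_edges m"
    unfolding query_blocks_def set_concat set_map by blast
qed

lemma fold_insertions:
  "fold apply_update (map (\<lambda>i. if P i then Insertion (f i) else Bot) xs) E = E \<union> f ` {i \<in> set xs. P i}"
  by (induction xs arbitrary: E) auto

lemma fold_assignments:
  assumes "inj f"
  shows "fold apply_update (map (\<lambda>i. if P i then Insertion (f i) else Deletion (f i)) xs) E
       = (E - f ` set xs) \<union> f ` {i \<in> set xs. P i}"
proof (induction xs arbitrary: E)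
  case (Cons x xs)
  then show ?case
    by (cases "P x") (auto simp: inj_image_mem_iff[OF assms] inj_eq[OF assms])
qed auto

lemma fold_data_path:
  assumes "D \<subseteq> {..<m}"
  shows "fold apply_update (data_block m D @ path_block m) {} = encoding_graph m D {}"
proof -
  have "{i. i < m \<and> i \<in> D} = D" using assms by auto
  then show ?thesis
    using fold_insertions[of "\<lambda>i. i \<in> D" "\<lambda>i. link i 3" "[0..<m]"]
      fold_insertions[of "\<lambda>_. True" "\<lambda>i. link i 0" "[0..<m]"]
      fold_insertions[of "\<lambda>_. True" "\<lambda>i. link i 1" "[0..<m]"]
    by (auto simp: data_block_def path_block_def encoding_graph_def lessThan_def)
qed

lemma fold_query_block:
  assumes "Q \<subseteq> {..<m}" "Q' \<subseteq> {..<m}"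
  shows "fold apply_update (query_block m Q) (encoding_graph m D Q') = encoding_graph m D Q"
proof -
  have "inj (\<lambda>i. link i 2)" by (simp add: inj_def link_inject)
  from fold_assignments[OF this, of "\<lambda>i. i \<in> Q" "[0..<m]" "encoding_graph m D Q'"]
  have "fold apply_update (query_block m Q) (encoding_graph m D Q')
      = (encoding_graph m D Q' - (\<lambda>i. link i 2) ` {..<m}) \<union> (\<lambda>i. link i 2) ` {i \<in> {..<m}. i \<in> Q}"
    by (simp add: query_block_def lessThan_atLeast0)
  moreover have "link i k \<noteq> link i' 2" if "k \<in> {0, 1, 3}" for i i' k
    using that link_inject[of k 2 i i'] by auto
  then have "encoding_graph m D Q' - (\<lambda>i. link i 2) ` {..<m} = encoding_graph m D {}"
    using assms(2) unfolding encoding_graph_def by fastforce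
  moreover have "{i \<in> {..<m}. i \<in> Q} = Q" using assms(1) by blast
  ultimately show ?thesis by (auto simp: encoding_graph_def)
qed

lemma fold_query_blocks:
  assumes "\<And>j. Q j \<subseteq> {..<m}"
  shows "fold apply_update (query_blocks m Q 0 j) (encoding_graph m D {})
       = encoding_graph m D (if j = 0 then {} else Q (j - 1))"
proof (induction j)
  case (Suc j)
  have "query_blocks m Q 0 (Suc j) = query_blocks m Q 0 j @ query_block m (Q j)"
    by (simp add: query_blocks_def)
  then show ?case using Suc assms by (simp add: fold_query_block)
qed (simp add: query_blocks_def)

text \<open>The data, path and query blocks take \<open>m\<close>, \<open>2 * m\<close> and
  \<open>m * m\<close> updates. The padding brings the length to \<open>T\<close> provided that
  \<open>3 * m + m * m \<le> T\<close>.\<close>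

definition encoding_stream :: "nat \<Rightarrow> nat \<Rightarrow> (nat \<Rightarrow> nat set) \<Rightarrow> nat set \<Rightarrow> update list" where
  "encoding_stream T m Q D =
     data_block m D @ path_block m @ query_blocks m Q 0 m @ replicate (T - (3 * m + m * m)) Bot"

text \<open>The time in question is the end of query block \<open>j\<close>, blocks being counted
  from 0, so only \<open>Q j\<close> is still visible.\<close>

lemma graph_at_encoding_stream:
  assumes "D \<subseteq> {..<m}" "\<And>j. Q j \<subseteq> {..<m}" "j < m"
  shows "graph_at (encoding_stream T m Q D) (3 * m + Suc j * m) = encoding_graph m D (Q j)"
proof -
  have "query_blocks m Q 0 m = query_blocks m Q 0 (Suc j) @ query_blocks m Q (Suc j) m"
    using assms(3) upt_add_eq_append[of 0 "Suc j" "m - Suc j"]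
    by (simp add: query_blocks_def del: upt_Suc)
  then have "encoding_stream T m Q D = (data_block m D @ path_block m @ query_blocks m Q 0 (Suc j)) @
      (query_blocks m Q (Suc j) m @ replicate (T - (3 * m + m * m)) Bot)"
    by (simp add: encoding_stream_def)
  then have "take (3 * m + Suc j * m) (encoding_stream T m Q D)
      = (data_block m D @ path_block m) @ query_blocks m Q 0 (Suc j)"
    by simp
  then show ?thesis
    unfolding graph_at_def
    using fold_data_path[OF assms(1)] fold_query_blocks[of Q m "Suc j" D] assms(2) by simp
qed

lemma edge_neighboring_data_block:
  assumes "data_block m D @ us \<in> dynamic_streams n T" "data_block m (insert i D) @ us \<in> dynamic_streams n T"
    and "i < m" "i \<notin> D"
  shows "edge_neighboring n T (data_block m (insert i D) @ us) (data_block m D @ us)"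
proof -
  have "(data_block m (insert i D) @ us) ! t = (data_block m D @ us) ! t" if "t \<noteq> i" for t
    using that by (simp add: nth_append) (simp add: data_block_def)
  moreover have "(data_block m D @ us) ! i = Bot" "(data_block m (insert i D) @ us) ! i \<noteq> Bot"
    using assms(3,4) by (simp_all add: nth_append) (simp_all add: data_block_def)
  moreover have "i < T" using assms(1,3) by (auto simp: dynamic_streams_def)
  ultimately show ?thesis using assms(1,2) unfolding edge_neighboring_def by blast
qed

section \<open>Lower bounds on the error in terms of n and T\<close>

lemma restricted_subset: "restricted_streams n T \<subseteq> dynamic_streams n T"
  by (auto simp: restricted_streams_def)

text \<open>This serves streams with \<open>1 \<le> T < 4\<close>, too short for the full encoding.
  A single edge, inserted or not in the first step, carries one bit, and the count reveals it
  directly.\<close>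

lemma error_bound_one_bit:
  assumes "continual_release n T \<A>" "edge_DP 1 n T \<A>" "\<zeta> \<ge> 0"
    and "components_accurate_on (restricted_streams n T) n T \<zeta> \<A>" and "n \<ge> 4" "T \<ge> 1"
  shows "1 \<le> 240 * \<zeta>\<^sup>2"
proof -
  define S where "S D = data_block 1 D @ replicate (T - 1) Bot" for D
  have S: "S D \<in> restricted_streams n T" for D
    unfolding S_def using assms(5,6) set_blocks(1)[of 1 D]
    by (intro restricted_streams_cycle_edges[of 1]) auto
  have "2 ^ 0 \<le> 240 * \<zeta>\<^sup>2"
  proof (rule reconstruction_lower_bound[OF assms(1-4) restricted_subset, where S = S and
        \<tau> = "\<lambda>_. 1" and C = "\<lambda>_. n"])
    fix i D assume "i < 2 ^ 0" "D \<subseteq> {..<2 ^ 0} - {i::nat}"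
    then show "edge_neighboring n T (S (insert i D)) (S D)"
      using subsetD[OF restricted_subset S] unfolding S_def by (intro edge_neighboring_data_block) auto
  next
    fix j D assume "D \<subseteq> {..<(2::nat) ^ 0}"
    then have "D = {} \<or> D = {0}" by auto
    moreover have "num_components n {link 0 3} = n - 1"
      using num_components_single_edge[of 3 n 0] assms(5) by (simp add: link_simps)
    ultimately show "real (num_components n (graph_at (S D) 1)) = real n - card {i\<in>D. hadamard 0 i j = 1}"
      using assms(5) by (auto simp: graph_at_def S_def data_block_def num_components_empty of_nat_diff)
  qed (use S assms(6) in auto)
  then show ?thesis by simp
qed

lemma error_bound_power_of_two:
  assumes "continual_release n T \<A>" "edge_DP 1 n T \<A>" "\<zeta> \<ge> 0"
    and "components_accurate_on (restricted_streams n T) n T \<zeta> \<A>"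
    and n: "4 * 2 ^ l \<le> n" and T: "4 * 2 ^ l * 2 ^ l \<le> T"
  shows "2 ^ l \<le> 240 * \<zeta>\<^sup>2"
proof -
  define m :: nat where "m = 2 ^ l"
  have m: "m \<ge> 1" "4 * m \<le> n" "0 < n" using n by (auto simp: m_def intro: less_le_trans[of 0 "4 * 2 ^ l"])
  have "m \<le> m * m" using m(1) by simp
  \<comment> \<open>The assumption on \<open>T\<close> is \<open>4 * m * m \<le> T\<close>, and
    \<open>3 * m \<le> 3 * m * m\<close>.\<close>
  then have T': "3 * m + m * m \<le> T" using T unfolding m_def[symmetric] mult.assoc by linarith
  \<comment> \<open>Setting the query edge where column \<open>j\<close> is -1 makes the secrets
    there invisible. The count then drops by a known amount plus the number of secret elements with
    entry +1.\<close>
  define Q where "Q j = {i. i < m \<and> hadamard l i j \<noteq> 1}" for j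
  define S where "S = encoding_stream T m Q"
  have Q: "Q j \<subseteq> {..<m}" for j by (auto simp: Q_def)
  have S: "S D \<in> restricted_streams n T" for D
    unfolding S_def encoding_stream_def
    using m T' set_blocks(1)[of m D] set_blocks(2)[of m] set_blocks(3)[of m Q 0 m]
    by (intro restricted_streams_cycle_edges[of m]) auto
  show ?thesis
  proof (rule reconstruction_lower_bound[OF assms(1-4) restricted_subset, where S = S and
        \<tau> = "\<lambda>j. 3 * m + Suc j * m" and C = "\<lambda>j. real n - 2 * m - card (Q j)"])
    fix i :: nat and D assume "i < 2 ^ l" "D \<subseteq> {..<2 ^ l} - {i}"
    then show "edge_neighboring n T (S (insert i D)) (S D)"
      using subsetD[OF restricted_subset S] unfolding S_def encoding_stream_def m_def
      by (intro edge_neighboring_data_block) auto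
  next
    fix j :: nat assume "j < 2 ^ l"
    then have "Suc j * m \<le> m * m" by (intro mult_le_mono1) (simp add: m_def)
    then have "3 * m + Suc j * m \<le> T" using T' by linarith
    then show "3 * m + Suc j * m \<in> {1..T}" using m(1) by auto
  next
    fix j :: nat and D :: "nat set" assume "j < 2 ^ l" "D \<subseteq> {..<2 ^ l}"
    then have jD: "j < m" "D \<subseteq> {..<m}" by (auto simp: m_def)
    have "D \<union> Q j = {i\<in>D. hadamard l i j = 1} \<union> Q j" using jD by (auto simp: Q_def)
    also have "card \<dots> = card {i\<in>D. hadamard l i j = 1} + card (Q j)"
      using jD(2) by (intro card_Un_disjoint) (auto simp: Q_def intro: finite_subset)
    finally have card: "card (D \<union> Q j) = card {i\<in>D. hadamard l i j = 1} + card (Q j)" .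
    have "card (D \<union> Q j) \<le> card {..<m}" using jD Q by (intro card_mono) auto
    then have "2 * m + card (D \<union> Q j) \<le> n" using m(2) by simp
    then show "real (num_components n (graph_at (S D) (3 * m + Suc j * m)))
        = real n - 2 * m - card (Q j) - card {i\<in>D. hadamard l i j = 1}"
      unfolding S_def graph_at_encoding_stream[where Q = Q, OF jD(2) Q jD(1)]
        num_components_encoding_graph[OF m(2) jD(2) Q]
      using card by (simp add: of_nat_diff)
  qed (use S in auto)
qed

text \<open>The largest \<open>l\<close> whose encoding fits is used; its successor violates one of
  the two size conditions, and this bounds \<open>n\<close> or \<open>T\<close> in terms of
  \<open>2 ^ l\<close>. The constant 48 is 3 * 16, from the case in which \<open>n\<close> is the
  bottleneck; the cases limited by \<open>T\<close> only need 32.\<close>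

lemma error_bound:
  assumes "continual_release n T \<A>" "edge_DP 1 n T \<A>" "\<zeta> \<ge> 0"
    and "components_accurate_on (restricted_streams n T) n T \<zeta> \<A>" and n: "n \<ge> 4"
  shows "\<zeta> \<ge> 1 / 48 * min (sqrt (real n)) (real T powr (1/4))"
proof -
  have root: "real T powr (1/4) = sqrt (sqrt T)"
    by (simp add: powr_half_sqrt[symmetric] powr_powr)
  \<comment> \<open>240 is rounded up to the square 256.\<close>
  have bound: "sqrt x \<le> 16 * \<zeta>" if "x \<le> 240 * \<zeta>\<^sup>2" for x
  proof -
    have "240 * \<zeta>\<^sup>2 \<le> (16 * \<zeta>)\<^sup>2" by (simp add: power_mult_distrib mult_right_mono)
    then have "x \<le> (16 * \<zeta>)\<^sup>2" using that by (rule order_trans[rotated])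
    then show ?thesis using assms(3) by (simp add: real_le_lsqrt)
  qed
  consider "T = 0" | "T \<ge> 1" "T < 4" | "T \<ge> 4" by linarith
  then show ?thesis
  proof cases
    case 1
    then show ?thesis using assms(3) by simp
  next
    case 2
    \<comment> \<open>The crude bound \<open>T \<le> 16\<close> gives the fourth root the value 2,
      which is at most 32\<zeta> by the one-bit bound.\<close>
    have "sqrt (sqrt T) \<le> sqrt (sqrt 16)" using 2 by (intro real_sqrt_le_mono) simp
    also have "sqrt (sqrt 16) = 2" by (simp add: real_sqrt_eq_iff real_sqrt_unique)
    finally show ?thesis
      using bound[OF error_bound_one_bit[OF assms 2(1)]]
        min.cobounded2[of "sqrt n" "sqrt (sqrt T)"] unfolding root real_sqrt_one by linarith
  next
    case 3
    define P where "P l \<longleftrightarrow> 4 * 2 ^ l \<le> n \<and> 4 * 2 ^ l * 2 ^ l \<le> T" for l :: nat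
    \<comment> \<open>Only finitely many \<open>l\<close> fit, so there is a last one.\<close>
    have "l \<le> n" if "P l" for l
      using that less_exp[of l] unfolding P_def by linarith
    moreover have "P 0" using n 3 by (simp add: P_def)
    ultimately obtain l where l: "P l" "\<not> P (Suc l)"
      by (metis Suc_n_not_le_n nat_induct)
    have *: "sqrt (2 ^ l) \<le> 16 * \<zeta>"
      using bound error_bound_power_of_two[OF assms(1-4)] l(1) unfolding P_def by blast
    \<comment> \<open>Failure of the first condition gives \<open>n < 8 * 2 ^ l\<close>; 8 is
      relaxed to the square 9.\<close>
    from l(2) consider "n < 9 * 2 ^ l" | "T < 4 * (2 * 2 ^ l) * (2 * 2 ^ l)"
      unfolding P_def by fastforce
    then show ?thesis
    proof cases
      case 1
      then have "real n \<le> 9 * 2 ^ l"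
        by (metis less_imp_le of_nat_le_iff of_nat_mult of_nat_numeral of_nat_power)
      then have "sqrt n \<le> sqrt (9 * 2 ^ l)" by (rule real_sqrt_le_mono)
      also have "\<dots> = 3 * sqrt (2 ^ l)" by (simp add: real_sqrt_mult real_sqrt_unique)
      finally show ?thesis using * min.cobounded1[of "sqrt n" "T powr (1/4)"] by linarith
    next
      case 2
      then have "T \<le> (4 * 2 ^ l)\<^sup>2" by (simp add: power2_eq_square)
      then have "real T \<le> real ((4 * 2 ^ l)\<^sup>2)" by (rule of_nat_mono)
      then have "sqrt T \<le> 4 * 2 ^ l" by (simp add: real_le_lsqrt)
      then have "sqrt (sqrt T) \<le> sqrt (4 * 2 ^ l)" by (rule real_sqrt_le_mono)
      also have "\<dots> = 2 * sqrt (2 ^ l)" by (simp add: real_sqrt_mult)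
      finally show ?thesis
        using * assms(3) min.cobounded2[of "sqrt n" "sqrt (sqrt T)"] unfolding root by linarith
    qed
  qed
qed

theorem theorem8p7:
  "(\<exists>c::real>0. \<exists>n\<^sub>0::nat. \<forall>n\<ge>n\<^sub>0. \<forall>(T::nat) (\<zeta>::real) (\<A>::mechanism).
      continual_release n T \<A> \<and> edge_DP 1 n T \<A> \<and> \<zeta> \<ge> 0 \<and>
      components_accurate_on (dynamic_streams n T) n T \<zeta> \<A>
      \<longrightarrow> \<zeta> \<ge> c * min (sqrt (real n)) (real T powr (1/4))) \<and>
   (\<exists>c::real>0. \<exists>n\<^sub>0::nat. \<forall>n\<ge>n\<^sub>0. \<forall>(T::nat) (\<zeta>::real) (\<A>::mechanism).
      continual_release n T \<A> \<and> edge_DP 1 n T \<A> \<and> \<zeta> \<ge> 0 \<and>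
      components_accurate_on (restricted_streams n T) n T \<zeta> \<A>
      \<longrightarrow> \<zeta> \<ge> c * min (sqrt (real n)) (real T powr (1/4)))"
proof (intro conjI exI[of _ "1 / 48 :: real"] exI[of _ "4 :: nat"] allI impI; (elim conjE)?)
  fix n T :: nat and \<zeta> :: real and \<A> :: mechanism
  assume *: "4 \<le> n" "continual_release n T \<A>" "edge_DP 1 n T \<A>" "0 \<le> \<zeta>"
  show "1 / 48 * min (sqrt (real n)) (real T powr (1/4)) \<le> \<zeta>"
    if "components_accurate_on (restricted_streams n T) n T \<zeta> \<A>"
    using error_bound[OF *(2-4) that *(1)] .
  \<comment> \<open>Accuracy on all streams includes accuracy on the restricted ones, so the first
    conjunct follows from the second.\<close>
  then show "1 / 48 * min (sqrt (real n)) (real T powr (1/4)) \<le> \<zeta>"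
    if "components_accurate_on (dynamic_streams n T) n T \<zeta> \<A>"
    using that restricted_subset[of n T] unfolding components_accurate_on_def by blast
qed simp_all

end
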